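(* The sequence $(u_k)_{k\ge 2}$ is complete in $H^2$ and is biorthogonal to $(h_k)_{k\ge 2}$ in $H^2$; that is, $\mathrm{span}\{u_k:k\ge2\}$ is dense in $H^2$ and $\langle h_k,u_j\rangle=\delta_{kj}$ for all $k,j\ge 2$.
   Context: $H^2$ is the Hardy space of holomorphic functions on the unit disk $\mathbb{D}$ with square-summable Taylor coefficients, with inner product $\langle f,g\rangle=\sum_{n\ge0}a_n\overline{b_n}$, where $(a_n),(b_n)$ are the Taylor coefficients of $f,g$. For $k\ge2$, $$h_k(z)=\frac{1}{1-z}\log\left(\frac{1+z+\dots+z^{k-1}}{k}\right),\quad z\in\mathbb{D},$$ with the holomorphic branch of the logarithm on $\mathbb{D}$ equal to $-\log k\in\mathbb{R}$ at $z=0$; each $h_k$ is known to belong to $H^2$. For $k\ge 2$, $$u_k(z)=\sum_{d\mid k}\frac{\mu(k/d)}{k/d}\,(z^{d-1}-z^d),$$ where $\mu$ is the Möbius function and the sum is over positive divisors $d$ of $k$. $\delta_{kj}$ is the Kronecker delta. *)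

theory Defs
  imports
    "HOL-Complex_Analysis.Complex_Analysis"
    "HOL-Computational_Algebra.Computational_Algebra"
begin

section \<open>The Hardy space of the unit disk\<close>

text \<open>
  Elements are represented by functions on the whole plane; only their values on the open unit
  disk matter.
\<close>

definition taylor_coeff :: "(complex \<Rightarrow> complex) \<Rightarrow> nat \<Rightarrow> complex" where
  "taylor_coeff f n = fps_nth (fps_expansion f 0) n"

definition hardy_space :: "(complex \<Rightarrow> complex) set" where
  "hardy_space =
     {f. f holomorphic_on ball 0 1 \<and> summable (\<lambda>n. (cmod (taylor_coeff f n))\<^sup>2)}"

definition hardy_inner :: "(complex \<Rightarrow> complex) \<Rightarrow> (complex \<Rightarrow> complex) \<Rightarrow> complex" where
  "hardy_inner f g = (\<Sum>n. taylor_coeff f n * cnj (taylor_coeff g n))"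

definition hardy_norm :: "(complex \<Rightarrow> complex) \<Rightarrow> real" where
  "hardy_norm f = sqrt (Re (hardy_inner f f))"

definition complex_span :: "(complex \<Rightarrow> complex) set \<Rightarrow> (complex \<Rightarrow> complex) set" where
  "complex_span S = {\<lambda>z. \<Sum>f\<in>F. c f * f z | F c. finite F \<and> F \<subseteq> S}"

definition hardy_dense :: "(complex \<Rightarrow> complex) set \<Rightarrow> bool" where
  "hardy_dense A \<longleftrightarrow>
     A \<subseteq> hardy_space \<and>
     (\<forall>f\<in>hardy_space. \<forall>e>0. \<exists>g\<in>A. hardy_norm (\<lambda>z. f z - g z) < e)"

definition hardy_complete :: "'i set \<Rightarrow> ('i \<Rightarrow> complex \<Rightarrow> complex) \<Rightarrow> bool" where
  "hardy_complete I v \<longleftrightarrow> hardy_dense (complex_span (v ` I))"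

text \<open>
  Membership in the space is part of biorthogonality, so that the inner products are those of
  square-summable sequences and never the default value of a divergent series.
\<close>

definition hardy_biorthogonal ::
    "'i set \<Rightarrow> ('i \<Rightarrow> complex \<Rightarrow> complex) \<Rightarrow> ('i \<Rightarrow> complex \<Rightarrow> complex) \<Rightarrow> bool" where
  "hardy_biorthogonal I v w \<longleftrightarrow>
     (\<forall>k\<in>I. v k \<in> hardy_space) \<and> (\<forall>j\<in>I. w j \<in> hardy_space) \<and>
     (\<forall>k\<in>I. \<forall>j\<in>I. hardy_inner (v k) (w j) = (if k = j then 1 else 0))"


section \<open>The functions $h_k$\<close>

definition is_log_branch :: "nat \<Rightarrow> (complex \<Rightarrow> complex) \<Rightarrow> bool" where
  "is_log_branch k g \<longleftrightarrow>
     g holomorphic_on ball 0 1 \<and>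
     (\<forall>z\<in>ball 0 1. exp (g z) = (\<Sum>j<k. z ^ j) / of_nat k) \<and>
     g 0 = - of_real (ln (real k))"

text \<open>
  For \<open>k \<ge> 1\<close> such a branch exists and is unique on the disk (\<open>is_log_branch_exists\<close> and
  \<open>is_log_branch_unique\<close> below), so the choice is immaterial there.
\<close>

definition log_branch :: "nat \<Rightarrow> complex \<Rightarrow> complex" where
  "log_branch k = (SOME g. is_log_branch k g)"

definition h :: "nat \<Rightarrow> complex \<Rightarrow> complex" where
  "h k z = 1 / (1 - z) * log_branch k z"

lemma is_log_branch_exists:
  assumes "k \<ge> 1"
  shows "\<exists>g. is_log_branch k g"
proof -
  define p where "p = (\<lambda>z::complex. (\<Sum>j<k. z ^ j) / of_nat k)"
  have k0: "(of_nat k :: complex) \<noteq> 0"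
    using assms by simp
  have nz: "p z \<noteq> 0" if "z \<in> ball 0 1" for z
  proof
    assume "p z = 0"
    then have "(\<Sum>j<k. z ^ j) = 0"
      using k0 by (simp add: p_def)
    then have "z ^ k = 1"
      using one_diff_power_eq[of z k] by simp
    then have "cmod z ^ k = 1"
      by (metis norm_one norm_power)
    moreover have "cmod z ^ k < 1"
      using that assms by (simp add: power_less_one_iff)
    ultimately show False
      by simp
  qed
  have "p holomorphic_on ball 0 1"
    unfolding p_def using k0 by (intro holomorphic_intros) auto
  then have "\<exists>g. g holomorphic_on ball 0 1 \<and> (\<forall>z\<in>ball 0 1. p z = exp (g z))"
    by (rule contractible_imp_holomorphic_log[OF _ convex_imp_contractible[OF convex_ball]])
       (use nz in auto)
  then obtain g where g: "g holomorphic_on ball 0 1"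
    and eg: "\<And>z. z \<in> ball 0 1 \<Longrightarrow> p z = exp (g z)"
    by blast
  have "p 0 = 1 / of_nat k"
  proof -
    obtain m where "k = Suc m"
      using assms by (cases k) auto
    then have "(\<Sum>j<k. (0::complex) ^ j) = 1"
      by (simp add: sum.lessThan_Suc_shift del: sum.lessThan_Suc)
    then show ?thesis
      by (simp add: p_def)
  qed
  then have e0: "exp (g 0) = 1 / of_nat k"
    using eg[of 0] by simp
  have ek: "exp (complex_of_real (ln (real k))) = of_nat k"
    using assms by (simp add: exp_of_real)
  have "is_log_branch k (\<lambda>z. g z - g 0 - of_real (ln (real k)))"
    unfolding is_log_branch_def
  proof (intro conjI ballI)
    show "(\<lambda>z. g z - g 0 - of_real (ln (real k))) holomorphic_on ball 0 1"
      by (intro holomorphic_intros g)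
    show "exp (g z - g 0 - of_real (ln (real k))) = (\<Sum>j<k. z ^ j) / of_nat k"
      if "z \<in> ball 0 1" for z
      using eg[OF that] k0 by (simp add: exp_diff e0 ek p_def)
  qed simp
  then show ?thesis
    by blast
qed

lemma is_log_branch_unique:
  assumes "is_log_branch k f" and "is_log_branch k g" and "z \<in> ball 0 1"
  shows "f z = g z"
proof -
  let ?d = "\<lambda>z. (f z - g z) / (2 * of_real pi * \<i>)"
  have ints: "?d w \<in> \<int>" if w: "w \<in> ball 0 1" for w
  proof -
    have "exp (f w) = exp (g w)"
      using assms w by (simp add: is_log_branch_def)
    then obtain n :: int where n: "f w = g w + (of_int (2 * n) * pi) * \<i>"
      by (auto simp: exp_eq)
    have "?d w = of_int n"
      unfolding n by (simp add: field_simps)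
    then show ?thesis
      by simp
  qed
  have cont: "continuous_on (ball 0 1) ?d"
    using assms unfolding is_log_branch_def
    by (intro continuous_intros holomorphic_on_imp_continuous_on) auto
  have "?d constant_on ball 0 1"
  proof (rule continuous_discrete_range_constant[OF connected_ball cont])
    fix x :: complex assume x: "x \<in> ball 0 1"
    show "\<exists>e>0. \<forall>y. y \<in> ball 0 1 \<and> ?d y \<noteq> ?d x \<longrightarrow> e \<le> norm (?d y - ?d x)"
    proof (intro exI[of _ 1] conjI allI impI)
      fix y assume y: "y \<in> ball 0 1 \<and> ?d y \<noteq> ?d x"
      obtain m n :: int where mn: "?d y = of_int m" "?d x = of_int n"
        using ints x y by (meson Ints_cases)
      then have "m \<noteq> n"
        using y by auto
      then have "1 \<le> \<bar>m - n\<bar>"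
        by linarith
      then have "1 \<le> norm (of_int (m - n) :: complex)"
        unfolding norm_of_int by linarith
      then show "1 \<le> norm (?d y - ?d x)"
        unfolding mn by simp
    qed simp
  qed
  then obtain c where c: "\<And>w. w \<in> ball 0 1 \<Longrightarrow> ?d w = c"
    unfolding constant_on_def by blast
  have "?d z = ?d 0"
    using c[OF assms(3)] c[of 0] by simp
  then show ?thesis
    using assms by (simp add: is_log_branch_def)
qed


section \<open>The functions $u_k$\<close>

definition moebius_mu :: "nat \<Rightarrow> int" where
  "moebius_mu n = (if squarefree n then (- 1) ^ card (prime_factors n) else 0)"

definition u :: "nat \<Rightarrow> complex \<Rightarrow> complex" where
  "u k z = (\<Sum>d | d dvd k. of_int (moebius_mu (k div d)) / of_nat (k div d) * (z ^ (d - 1) - z ^ d))"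

end

theory Submission
  imports Defs
begin

text \<open>
  \<^bold>\<open>Biorthogonality.\<close> The logarithm in \<open>h k\<close> is \<open>Ln (1 - z ^ k) - Ln (1 - z) - ln k\<close>. Dividing its power
  series by \<open>1 - z\<close> forms partial sums, so the coefficients of \<open>h k\<close> are
  \<open>harm n - harm (n div k) - ln k\<close> (\<open>taylor_coeff_h\<close>). They are of order \<open>1 / n\<close>, hence
  square-summable. Conversely, pairing with \<open>z ^ (d - 1) - z ^ d\<close> takes differences of consecutive
  coefficients and returns the coefficients \<open>1 / d - (k / d) * [k dvd d]\<close> of the logarithm up to
  sign. The pairing of \<open>h k\<close> with \<open>u j\<close> thereby becomes a divisor sum, which the identity
  \<open>sum_moebius_mu_codivisors\<close> evaluates (\<open>hardy_inner_h_u\<close>).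

  \<^bold>\<open>Completeness.\<close> Write \<open>e n\<close> for \<open>z ^ (n - 1) - z ^ n\<close> (\<open>diff_power\<close>). By Moebius inversion all
  \<open>n * e n - e 1\<close> lie in the span of \<open>u 2, u 3, \<dots>\<close> (\<open>diff_power_congruent_in_u_span\<close>). If a square-summable
  sequence is orthogonal to them, its consecutive differences are a constant multiple of \<open>1 / n\<close>;
  as the harmonic series diverges, the constant is zero, and then the sequence is zero. The proof
  replaces this duality argument by explicit approximations with the same content: divergence of the
  harmonic series puts \<open>e 1\<close> into the closure of the span (\<open>diff_power_1_in_closure\<close>), hence all \<open>e n\<close>
  and their sums \<open>1 - z ^ n\<close>; the means of \<open>1 - z ^ n\<close> converge to 1 in norm
  (\<open>one_in_closure\<close>); so the closure contains all powers of \<open>z\<close> and is the whole space.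
\<close>

section \<open>Taylor coefficients and the Hardy norm\<close>

lemma taylor_coeff_eqI: "f has_fps_expansion F \<Longrightarrow> taylor_coeff f n = fps_nth F n"
  unfolding taylor_coeff_def
  by (simp add: fps_nth_fps_expansion fps_expansion_def)

lemma holomorphic_has_fps_expansion:
  "f holomorphic_on ball 0 1 \<Longrightarrow> f has_fps_expansion fps_expansion f 0"
  by (rule has_fps_expansion_fps_expansion[of "ball 0 1"]) auto

lemma taylor_coeff_add:
  assumes "f holomorphic_on ball 0 1" "g holomorphic_on ball 0 1"
  shows "taylor_coeff (\<lambda>z. f z + g z) n = taylor_coeff f n + taylor_coeff g n"
  using taylor_coeff_eqI[OF has_fps_expansion_add[OF assms[THEN holomorphic_has_fps_expansion]]]
  by (simp add: taylor_coeff_def)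

lemma taylor_coeff_cmult:
  assumes "f holomorphic_on ball 0 1"
  shows "taylor_coeff (\<lambda>z. c * f z) n = c * taylor_coeff f n"
  using taylor_coeff_eqI[OF has_fps_expansion_cmult_left[OF assms[THEN holomorphic_has_fps_expansion]]]
  by (simp add: taylor_coeff_def)

lemma taylor_coeff_power: "taylor_coeff (\<lambda>z. z ^ m) n = (if n = m then 1 else 0)"
  using taylor_coeff_eqI[OF has_fps_expansion_fps_X_power[of m]] by simp

lemma taylor_coeff_sum:
  assumes "\<And>i. i \<in> I \<Longrightarrow> f i holomorphic_on ball 0 1"
  shows "taylor_coeff (\<lambda>z. \<Sum>i\<in>I. f i z) n = (\<Sum>i\<in>I. taylor_coeff (f i) n)"
  using taylor_coeff_eqI[OF has_fps_expansion_sum[OF holomorphic_has_fps_expansion[OF assms]]]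
  by (simp add: taylor_coeff_def fps_sum_nth)

lemma taylor_coeff_polynomial:
  assumes "finite I"
  shows "taylor_coeff (\<lambda>z. \<Sum>n\<in>I. c n * z ^ n) n = (if n \<in> I then c n else 0)"
proof -
  have "taylor_coeff (\<lambda>z. \<Sum>n\<in>I. c n * z ^ n) n = (\<Sum>m\<in>I. taylor_coeff (\<lambda>z. c m * z ^ m) n)"
    by (intro taylor_coeff_sum holomorphic_intros)
  also have "\<dots> = (\<Sum>m\<in>I. if m = n then c m else 0)"
    by (intro sum.cong refl, subst taylor_coeff_cmult)
       (auto simp: taylor_coeff_power intro!: holomorphic_intros)
  also have "\<dots> = (if n \<in> I then c n else 0)"
    using assms by (simp add: sum.delta)
  finally show ?thesis .
qed

lemma hardy_space_holomorphic: "f \<in> hardy_space \<Longrightarrow> f holomorphic_on ball 0 1"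
  by (simp add: hardy_space_def)

lemma hardy_space_summable: "f \<in> hardy_space \<Longrightarrow> summable (\<lambda>n. (cmod (taylor_coeff f n))\<^sup>2)"
  by (simp add: hardy_space_def)

text \<open>The terms of the inner product of \<open>f\<close> with itself are real, so taking the real part in the
  definition of the norm loses nothing.\<close>

lemma hardy_norm_eq:
  assumes "f \<in> hardy_space"
  shows "hardy_norm f = sqrt (\<Sum>n. (cmod (taylor_coeff f n))\<^sup>2)"
proof -
  have "(\<lambda>n. complex_of_real ((cmod (taylor_coeff f n))\<^sup>2)) sums
          of_real (\<Sum>n. (cmod (taylor_coeff f n))\<^sup>2)"
    using hardy_space_summable[OF assms] by (intro sums_of_real summable_sums)
  then have "hardy_inner f f = of_real (\<Sum>n. (cmod (taylor_coeff f n))\<^sup>2)"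
    unfolding hardy_inner_def by (simp only: complex_norm_square sums_iff)
  then show ?thesis
    by (simp add: hardy_norm_def)
qed

lemma hardy_norm_nonneg: "f \<in> hardy_space \<Longrightarrow> 0 \<le> hardy_norm f"
  by (simp add: hardy_norm_eq suminf_nonneg hardy_space_summable)

lemma L2_set_le_hardy_norm:
  assumes "f \<in> hardy_space"
  shows "L2_set (\<lambda>n. cmod (taylor_coeff f n)) {..<N} \<le> hardy_norm f"
  unfolding L2_set_def hardy_norm_eq[OF assms]
  by (intro real_sqrt_le_mono sum_le_suminf hardy_space_summable assms) auto

text \<open>Minkowski's inequality for square-summable sequences: the finite inequality bounds all
  partial sums, which gives summability and the estimate of the norm at once.\<close>

lemma
  assumes f: "f \<in> hardy_space" and g: "g \<in> hardy_space"
  shows hardy_space_add: "(\<lambda>z. f z + g z) \<in> hardy_space"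
    and hardy_norm_triangle: "hardy_norm (\<lambda>z. f z + g z) \<le> hardy_norm f + hardy_norm g"
proof -
  let ?s = "\<lambda>z. f z + g z"
  let ?B = "hardy_norm f + hardy_norm g"
  have B: "0 \<le> ?B"
    using hardy_norm_nonneg f g by (simp add: add_nonneg_nonneg)
  have hol: "?s holomorphic_on ball 0 1"
    using f g by (intro holomorphic_intros hardy_space_holomorphic)
  have coeff: "taylor_coeff ?s n = taylor_coeff f n + taylor_coeff g n" for n
    using f g by (intro taylor_coeff_add hardy_space_holomorphic)
  have partial: "(\<Sum>n<N. (cmod (taylor_coeff ?s n))\<^sup>2) \<le> ?B\<^sup>2" for N
  proof -
    have "sqrt (\<Sum>n<N. (cmod (taylor_coeff ?s n))\<^sup>2) = L2_set (\<lambda>n. cmod (taylor_coeff ?s n)) {..<N}"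
      by (simp add: L2_set_def)
    also have "\<dots> \<le> L2_set (\<lambda>n. cmod (taylor_coeff f n) + cmod (taylor_coeff g n)) {..<N}"
      by (intro L2_set_mono) (auto simp: coeff norm_triangle_ineq)
    also have "\<dots> \<le> L2_set (\<lambda>n. cmod (taylor_coeff f n)) {..<N}
                    + L2_set (\<lambda>n. cmod (taylor_coeff g n)) {..<N}"
      by (rule L2_set_triangle_ineq)
    also have "\<dots> \<le> ?B"
      by (intro add_mono L2_set_le_hardy_norm f g)
    finally show ?thesis
      using B by (simp add: sqrt_le_D)
  qed
  have sm: "summable (\<lambda>n. (cmod (taylor_coeff ?s n))\<^sup>2)"
    by (rule bounded_imp_summable[where B = "?B\<^sup>2"])
       (use partial[of "Suc _"] in \<open>auto simp: lessThan_Suc_atMost\<close>)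
  show mem: "?s \<in> hardy_space"
    using hol sm by (simp add: hardy_space_def)
  show "hardy_norm ?s \<le> ?B"
    unfolding hardy_norm_eq[OF mem]
    using B by (intro real_le_lsqrt suminf_le_const sm partial) auto
qed

lemma
  assumes f: "f \<in> hardy_space"
  shows hardy_space_cmult: "(\<lambda>z. c * f z) \<in> hardy_space"
    and hardy_norm_cmult: "hardy_norm (\<lambda>z. c * f z) = cmod c * hardy_norm f"
proof -
  have coeff: "(cmod (taylor_coeff (\<lambda>z. c * f z) n))\<^sup>2 = (cmod c)\<^sup>2 * (cmod (taylor_coeff f n))\<^sup>2" for n
    using f by (simp add: taylor_coeff_cmult hardy_space_holomorphic norm_mult power_mult_distrib)
  show mem: "(\<lambda>z. c * f z) \<in> hardy_space"
    using f by (auto simp: hardy_space_def coeff[unfolded power2_eq_square] power2_eq_square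
        intro!: holomorphic_intros summable_mult)
  show "hardy_norm (\<lambda>z. c * f z) = cmod c * hardy_norm f"
    by (simp add: hardy_norm_eq[OF mem] hardy_norm_eq[OF f] coeff real_sqrt_mult
        suminf_mult[OF hardy_space_summable[OF f]])
qed

lemma hardy_space_diff:
  "f \<in> hardy_space \<Longrightarrow> g \<in> hardy_space \<Longrightarrow> (\<lambda>z. f z - g z) \<in> hardy_space"
  using hardy_space_add[OF _ hardy_space_cmult[of g "-1"], of f] by simp

text \<open>A polynomial has finitely many Taylor coefficients, so its norm is a finite sum.\<close>

lemma
  assumes "finite I"
  shows hardy_space_polynomial: "(\<lambda>z. \<Sum>n\<in>I. c n * z ^ n) \<in> hardy_space"
    and hardy_norm_polynomial:
      "hardy_norm (\<lambda>z. \<Sum>n\<in>I. c n * z ^ n) = sqrt (\<Sum>n\<in>I. (cmod (c n))\<^sup>2)"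
proof -
  let ?p = "\<lambda>z. \<Sum>n\<in>I. c n * z ^ n"
  have sums: "(\<lambda>n. (cmod (taylor_coeff ?p n))\<^sup>2) sums (\<Sum>n\<in>I. (cmod (c n))\<^sup>2)"
    using sums_If_finite_set[OF assms, of "\<lambda>n. (cmod (c n))\<^sup>2"]
    by (simp add: taylor_coeff_polynomial[OF assms] if_distrib[of cmod] if_distrib[of "\<lambda>x. x\<^sup>2"] cong: if_cong)
  show mem: "?p \<in> hardy_space"
    using sums by (auto simp: hardy_space_def sums_iff intro!: holomorphic_intros)
  show "hardy_norm ?p = sqrt (\<Sum>n\<in>I. (cmod (c n))\<^sup>2)"
    using sums by (simp add: hardy_norm_eq[OF mem] sums_iff)
qed

lemma hardy_space_power: "(\<lambda>z. z ^ n) \<in> hardy_space"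
  and hardy_norm_power: "hardy_norm (\<lambda>z. z ^ n) = 1"
  using hardy_space_polynomial[of "{n}" "\<lambda>_. 1"] hardy_norm_polynomial[of "{n}" "\<lambda>_. 1"] by simp_all

lemma hardy_space_zero: "(\<lambda>z. 0) \<in> hardy_space"
  using hardy_space_polynomial[of "{}"] by simp

lemma hardy_norm_zero: "hardy_norm (\<lambda>z. 0) = 0"
  using hardy_norm_polynomial[of "{}"] by simp


section \<open>Subspaces, closures and density\<close>

definition hardy_subspace :: "(complex \<Rightarrow> complex) set \<Rightarrow> bool" where
  "hardy_subspace A \<longleftrightarrow>
     A \<subseteq> hardy_space \<and> (\<lambda>z. 0) \<in> A \<and>
     (\<forall>f\<in>A. \<forall>g\<in>A. (\<lambda>z. f z + g z) \<in> A) \<and> (\<forall>c. \<forall>f\<in>A. (\<lambda>z. c * f z) \<in> A)"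

definition hardy_closure :: "(complex \<Rightarrow> complex) set \<Rightarrow> (complex \<Rightarrow> complex) set" where
  "hardy_closure A = {f\<in>hardy_space. \<forall>e>0. \<exists>g\<in>A. hardy_norm (\<lambda>z. f z - g z) < e}"

lemma hardy_subspace_space: "hardy_subspace A \<Longrightarrow> f \<in> A \<Longrightarrow> f \<in> hardy_space"
  by (auto simp: hardy_subspace_def)

lemma hardy_subspace_zero: "hardy_subspace A \<Longrightarrow> (\<lambda>z. 0) \<in> A"
  by (simp add: hardy_subspace_def)

lemma hardy_subspace_add:
  "hardy_subspace A \<Longrightarrow> f \<in> A \<Longrightarrow> g \<in> A \<Longrightarrow> (\<lambda>z. f z + g z) \<in> A"
  by (simp add: hardy_subspace_def)

lemma hardy_subspace_cmult: "hardy_subspace A \<Longrightarrow> f \<in> A \<Longrightarrow> (\<lambda>z. c * f z) \<in> A"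
  by (simp add: hardy_subspace_def)

lemma hardy_subspace_diff:
  "hardy_subspace A \<Longrightarrow> f \<in> A \<Longrightarrow> g \<in> A \<Longrightarrow> (\<lambda>z. f z - g z) \<in> A"
  using hardy_subspace_add[of A f "\<lambda>z. -1 * g z"] hardy_subspace_cmult[of A g "-1"] by simp

lemma hardy_subspace_sum:
  assumes "hardy_subspace A" "\<And>i. i \<in> I \<Longrightarrow> f i \<in> A"
  shows "(\<lambda>z. \<Sum>i\<in>I. f i z) \<in> A"
  using assms(2)
  by (induction I rule: infinite_finite_induct)
     (auto intro!: hardy_subspace_zero hardy_subspace_add assms(1))

lemma hardy_subspace_hardy_space: "hardy_subspace hardy_space"
  by (simp add: hardy_subspace_def hardy_space_zero hardy_space_add hardy_space_cmult)

lemma in_complex_span: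
  assumes "f \<in> S"
  shows "f \<in> complex_span S"
  unfolding complex_span_def
  by (rule CollectI, rule exI[of _ "{f}"], rule exI[of _ "\<lambda>_. 1"]) (use assms in auto)

lemma hardy_subspace_complex_span:
  assumes S: "S \<subseteq> hardy_space"
  shows "hardy_subspace (complex_span S)"
  unfolding hardy_subspace_def
proof (intro conjI ballI allI subsetI)
  fix f assume "f \<in> complex_span S"
  then obtain F c where "finite F" "F \<subseteq> S" "f = (\<lambda>z. \<Sum>g\<in>F. c g * g z)"
    unfolding complex_span_def by blast
  then show "f \<in> hardy_space"
    using S by (auto intro!: hardy_subspace_sum hardy_subspace_hardy_space hardy_space_cmult)
next
  show "(\<lambda>z. 0) \<in> complex_span S"
    unfolding complex_span_def
    by (rule CollectI, rule exI[of _ "{}"]) simp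
next
  fix f g assume "f \<in> complex_span S" "g \<in> complex_span S"
  then obtain F c G d where F: "finite F" "F \<subseteq> S" and f: "f = (\<lambda>z. \<Sum>k\<in>F. c k * k z)"
    and G: "finite G" "G \<subseteq> S" and g: "g = (\<lambda>z. \<Sum>k\<in>G. d k * k z)"
    unfolding complex_span_def by blast
  let ?c = "\<lambda>k. (if k \<in> F then c k else 0) + (if k \<in> G then d k else 0)"
  have "f z + g z = (\<Sum>k\<in>F \<union> G. ?c k * k z)" for z
  proof -
    have "f z = (\<Sum>k\<in>F \<union> G. (if k \<in> F then c k else 0) * k z)"
      unfolding f using F G by (intro sum.mono_neutral_cong_left) auto
    moreover have "g z = (\<Sum>k\<in>F \<union> G. (if k \<in> G then d k else 0) * k z)"
      unfolding g using F G by (intro sum.mono_neutral_cong_left) auto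
    ultimately show ?thesis
      by (simp add: sum.distrib ring_distribs)
  qed
  then show "(\<lambda>z. f z + g z) \<in> complex_span S"
    unfolding complex_span_def
    by (intro CollectI exI[of _ "F \<union> G"] exI[of _ ?c]) (use F G in auto)
next
  fix a f assume "f \<in> complex_span S"
  then obtain F c where F: "finite F" "F \<subseteq> S" and f: "f = (\<lambda>z. \<Sum>k\<in>F. c k * k z)"
    unfolding complex_span_def by blast
  then show "(\<lambda>z. a * f z) \<in> complex_span S"
    unfolding complex_span_def
    by (intro CollectI exI[of _ F] exI[of _ "\<lambda>k. a * c k"]) (simp add: sum_distrib_left mult.assoc)
qed

lemma hardy_closure_superset:
  assumes "hardy_subspace A" "f \<in> A"
  shows "f \<in> hardy_closure A"
proof -
  have "\<exists>g\<in>A. hardy_norm (\<lambda>z. f z - g z) < e" if "e > 0" for e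
    using assms that by (intro bexI[of _ f]) (simp_all add: hardy_norm_zero)
  then show ?thesis
    using hardy_subspace_space[OF assms] by (simp add: hardy_closure_def)
qed

lemma hardy_subspace_closure:
  assumes A: "hardy_subspace A"
  shows "hardy_subspace (hardy_closure A)"
  unfolding hardy_subspace_def
proof (intro conjI ballI allI)
  show "hardy_closure A \<subseteq> hardy_space"
    by (auto simp: hardy_closure_def)
  show "(\<lambda>z. 0) \<in> hardy_closure A"
    by (intro hardy_closure_superset A hardy_subspace_zero)
next
  fix f g assume f: "f \<in> hardy_closure A" and g: "g \<in> hardy_closure A"
  have fg: "f \<in> hardy_space" "g \<in> hardy_space"
    using f g by (auto simp: hardy_closure_def)
  have "\<exists>k\<in>A. hardy_norm (\<lambda>z. (f z + g z) - k z) < e" if "e > 0" for e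
  proof -
    obtain f' g' where f': "f' \<in> A" "hardy_norm (\<lambda>z. f z - f' z) < e / 2"
      and g': "g' \<in> A" "hardy_norm (\<lambda>z. g z - g' z) < e / 2"
      using f g \<open>e > 0\<close> unfolding hardy_closure_def by (auto dest!: spec[of _ "e / 2"])
    have "hardy_norm (\<lambda>z. (f z - f' z) + (g z - g' z)) < e"
      using f' g' fg A
        hardy_norm_triangle[of "\<lambda>z. f z - f' z" "\<lambda>z. g z - g' z"]
        hardy_space_diff[OF fg(1) hardy_subspace_space[OF A f'(1)]]
        hardy_space_diff[OF fg(2) hardy_subspace_space[OF A g'(1)]]
      by simp
    then show ?thesis
      using hardy_subspace_add[OF A f'(1) g'(1)]
      by (intro bexI[of _ "\<lambda>z. f' z + g' z"]) (simp_all add: algebra_simps)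
  qed
  then show "(\<lambda>z. f z + g z) \<in> hardy_closure A"
    using fg by (simp add: hardy_closure_def hardy_space_add)
next
  fix c f assume f: "f \<in> hardy_closure A"
  have fs: "f \<in> hardy_space"
    using f by (auto simp: hardy_closure_def)
  have "\<exists>k\<in>A. hardy_norm (\<lambda>z. c * f z - k z) < e" if "e > 0" for e
  proof -
    \<comment> \<open>The summand 1 covers the case that \<open>c\<close> is zero.\<close>
    have pos: "e / (cmod c + 1) > 0"
      using \<open>e > 0\<close> by (simp add: add_nonneg_pos)
    then obtain g where g: "g \<in> A" "hardy_norm (\<lambda>z. f z - g z) < e / (cmod c + 1)"
      using f unfolding hardy_closure_def by blast
    have gs: "(\<lambda>z. f z - g z) \<in> hardy_space"
      by (rule hardy_space_diff[OF fs hardy_subspace_space[OF A g(1)]])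
    have "hardy_norm (\<lambda>z. c * (f z - g z)) \<le> (cmod c + 1) * hardy_norm (\<lambda>z. f z - g z)"
      unfolding hardy_norm_cmult[OF gs] using hardy_norm_nonneg[OF gs] by (intro mult_right_mono) auto
    also have "\<dots> < e"
      using g(2) by (simp add: pos_less_divide_eq add_nonneg_pos mult.commute)
    finally show ?thesis
      using hardy_subspace_cmult[OF A g(1)]
      by (intro bexI[of _ "\<lambda>z. c * g z"]) (simp_all add: algebra_simps)
  qed
  then show "(\<lambda>z. c * f z) \<in> hardy_closure A"
    using fs by (simp add: hardy_closure_def hardy_space_cmult)
qed

lemma hardy_closure_closed:
  assumes A: "hardy_subspace A" and f: "f \<in> hardy_space"
    and approx: "\<And>e. e > 0 \<Longrightarrow> \<exists>g\<in>hardy_closure A. hardy_norm (\<lambda>z. f z - g z) < e"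
  shows "f \<in> hardy_closure A"
proof -
  have "\<exists>k\<in>A. hardy_norm (\<lambda>z. f z - k z) < e" if "e > 0" for e
  proof -
    obtain g where g: "g \<in> hardy_closure A" "hardy_norm (\<lambda>z. f z - g z) < e / 2"
      using approx[of "e / 2"] \<open>e > 0\<close> by auto
    then obtain k where k: "k \<in> A" "hardy_norm (\<lambda>z. g z - k z) < e / 2"
      using \<open>e > 0\<close> unfolding hardy_closure_def by (auto dest!: spec[of _ "e / 2"])
    have gs: "g \<in> hardy_space"
      using g by (simp add: hardy_closure_def)
    have "hardy_norm (\<lambda>z. (f z - g z) + (g z - k z)) < e"
      using g k hardy_norm_triangle[of "\<lambda>z. f z - g z" "\<lambda>z. g z - k z"]
        hardy_space_diff[OF f gs] hardy_space_diff[OF gs hardy_subspace_space[OF A k(1)]]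
      by simp
    then show ?thesis
      using k by (intro bexI[of _ k]) simp_all
  qed
  then show ?thesis
    using f by (simp add: hardy_closure_def)
qed

text \<open>The Taylor polynomials of \<open>f\<close> converge to \<open>f\<close> in norm, because the square of the distance
  is a tail of the convergent series of squared coefficients.\<close>

lemma hardy_space_subset_closure_if_powers:
  assumes A: "hardy_subspace A" and pow: "\<And>n. (\<lambda>z. z ^ n) \<in> hardy_closure A"
  shows "hardy_space \<subseteq> hardy_closure A"
proof
  fix f assume f: "f \<in> hardy_space"
  show "f \<in> hardy_closure A"
  proof (rule hardy_closure_closed[OF A f])
    fix e :: real assume "e > 0"
    let ?a = "taylor_coeff f"
    let ?b = "\<lambda>n. (cmod (?a n))\<^sup>2"
    have sm: "summable ?b"
      by (rule hardy_space_summable[OF f])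
    obtain N where N: "norm (\<Sum>i. ?b (i + N)) < e\<^sup>2"
      using suminf_exist_split[OF _ sm, of "e\<^sup>2"] \<open>e > 0\<close> by auto
    define p where "p = (\<lambda>z. \<Sum>n<N. ?a n * z ^ n)"
    have p: "p \<in> hardy_space" "p \<in> hardy_closure A"
      unfolding p_def
      by (auto intro!: hardy_space_polynomial hardy_subspace_sum hardy_subspace_cmult
          hardy_subspace_closure A pow)
    have cp: "taylor_coeff p n = (if n < N then ?a n else 0)" for n
      unfolding p_def by (simp add: taylor_coeff_polynomial)
    let ?d = "\<lambda>z. f z - p z"
    have d: "?d \<in> hardy_space"
      by (rule hardy_space_diff[OF f p(1)])
    have "taylor_coeff (\<lambda>z. p z + ?d z) n = taylor_coeff p n + taylor_coeff ?d n" for n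
      by (rule taylor_coeff_add[OF p(1)[THEN hardy_space_holomorphic] d[THEN hardy_space_holomorphic]])
    then have cd: "taylor_coeff ?d n = (if n < N then 0 else ?a n)" for n
      using cp[of n] by (simp split: if_splits)
    have "(\<Sum>n. (cmod (taylor_coeff ?d n))\<^sup>2) = (\<Sum>i. ?b (i + N))"
      using suminf_split_initial_segment[OF hardy_space_summable[OF d], of N] by (simp add: cd)
    also have "\<dots> < e\<^sup>2"
      using N by simp
    finally have "hardy_norm ?d < e"
      unfolding hardy_norm_eq[OF d] using \<open>e > 0\<close> by (simp add: real_less_lsqrt)
    then show "\<exists>g\<in>hardy_closure A. hardy_norm (\<lambda>z. f z - g z) < e"
      using p by blast
  qed
qed


section \<open>Divisor sums of the Moebius function\<close>

lemma moebius_mu_prime_mult: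
  assumes p: "prime p" "\<not> p dvd d" and d: "squarefree d"
  shows "squarefree (p * d)" and "moebius_mu (p * d) = - moebius_mu d"
proof -
  show sq: "squarefree (p * d)"
    by (rule squarefree_mult_coprime[OF prime_imp_coprime[OF p] squarefree_prime[OF p(1)] d])
  have "d \<noteq> 0"
    using p(2) by (metis dvd_0_right)
  then have "prime_factors (p * d) = insert p (prime_factors d)"
    using p(1) by (simp add: prime_factors_product prime_gt_0_nat prime_prime_factors)
  moreover have "p \<notin> prime_factors d"
    using p by auto
  ultimately show "moebius_mu (p * d) = - moebius_mu d"
    using sq d by (simp add: moebius_mu_def)
qed

text \<open>For a prime \<open>p\<close> dividing \<open>n\<close>, multiplication by \<open>p\<close> pairs the squarefree divisors of \<open>n\<close>
  prime to \<open>p\<close> with the others and changes the sign of the Moebius function, so everything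
  cancels unless \<open>n = 1\<close>.\<close>

lemma sum_moebius_mu_divisors:
  assumes "n > 0"
  shows "(\<Sum>d | d dvd n. moebius_mu d) = (if n = 1 then 1 else 0)"
proof (cases "n = 1")
  case True
  then show ?thesis
    by (simp add: moebius_mu_def)
next
  case False
  then obtain p where p: "prime p" "p dvd n"
    using prime_factor_nat by blast
  define A where "A = {d. d dvd n \<and> squarefree d \<and> \<not> p dvd d}"
  have fin: "finite {d. d dvd n}"
    using assms by simp
  have finA: "finite A"
    by (rule finite_subset[OF _ fin]) (auto simp: A_def)
  have split: "{d. d dvd n \<and> squarefree d} = A \<union> (*) p ` A" (is "?S = _")
  proof (intro equalityI subsetI)
    fix d assume d: "d \<in> ?S"
    show "d \<in> A \<union> (*) p ` A"
    proof (cases "p dvd d")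
      case True
      then obtain q where q: "d = p * q" ..
      have "\<not> p dvd q"
      proof
        assume "p dvd q"
        then have "p\<^sup>2 dvd d"
          by (simp add: q power2_eq_square)
        then show False
          using d p(1) by (auto simp: squarefree_def dest: squarefreeD)
      qed
      moreover have "q dvd n" "squarefree q"
        using d q by (auto dest: squarefree_multD dvd_mult_right)
      ultimately show ?thesis
        by (auto simp: A_def q)
    qed (use d in \<open>auto simp: A_def\<close>)
  next
    fix d assume "d \<in> A \<union> (*) p ` A"
    then show "d \<in> ?S"
    proof
      assume "d \<in> (*) p ` A"
      then obtain q where q: "q \<in> A" "d = p * q"
        by auto
      then have "p * q dvd n"
        using p by (intro divides_mult) (auto simp: A_def prime_imp_coprime)
      then show ?thesis
        using q p(1) by (auto simp: A_def moebius_mu_prime_mult)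
    qed (auto simp: A_def)
  qed
  have "(\<Sum>d | d dvd n. moebius_mu d) = sum moebius_mu ?S"
    using fin by (intro sum.mono_neutral_right) (auto simp: moebius_mu_def)
  also have "\<dots> = sum moebius_mu A + sum moebius_mu ((*) p ` A)"
    unfolding split using finA by (intro sum.union_disjoint) (auto simp: A_def)
  also have "sum moebius_mu ((*) p ` A) = (\<Sum>d\<in>A. moebius_mu (p * d))"
    using p(1) by (subst sum.reindex) (auto simp: inj_on_def prime_gt_0_nat)
  also have "\<dots> = - sum moebius_mu A"
    using p(1) by (simp add: A_def moebius_mu_prime_mult sum_negf[symmetric])
  finally show ?thesis
    using False by simp
qed

lemma sum_moebius_mu_codivisors:
  assumes "n > 0"
  shows "(\<Sum>d | d dvd n. moebius_mu (n div d)) = (if n = 1 then 1 else 0)"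
proof -
  have "(\<Sum>d | d dvd n. moebius_mu (n div d)) = (\<Sum>d | d dvd n. moebius_mu d)"
    using assms
    by (intro sum.reindex_bij_witness[of _ "\<lambda>d. n div d" "\<lambda>d. n div d"])
       (auto simp: div_div_eq_right elim!: dvdE)
  then show ?thesis
    using sum_moebius_mu_divisors[OF assms] by simp
qed

text \<open>The divisors of \<open>j\<close> that are multiples of \<open>k\<close> correspond to the divisors of \<open>j div k\<close>.\<close>

lemma sum_moebius_mu_multiples:
  assumes "j > 0" "k > 0"
  shows "(\<Sum>d | d dvd j \<and> k dvd d. moebius_mu (j div d)) = (if j = k then 1 else 0)"
proof (cases "k dvd j")
  case True
  then obtain m where m: "j = k * m" ..
  then have "m > 0"
    using assms by simp
  have "(\<Sum>d | d dvd j \<and> k dvd d. moebius_mu (j div d)) = (\<Sum>d | d dvd m. moebius_mu (m div d))"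
    using assms
    by (intro sum.reindex_bij_witness[of _ "\<lambda>d. k * d" "\<lambda>d. d div k"]) (auto simp: m)
  then show ?thesis
    using sum_moebius_mu_codivisors[OF \<open>m > 0\<close>] assms by (simp add: m)
next
  case False
  then have "{d. d dvd j \<and> k dvd d} = {}"
    by (auto dest: dvd_trans)
  then show ?thesis
    using False by (auto simp del: Collect_empty_eq)
qed


section \<open>The coefficients of $h_k$\<close>

lemma is_log_branch_Ln:
  assumes "k \<ge> 1"
  shows "is_log_branch k (\<lambda>z. Ln (1 - z ^ k) - Ln (1 - z) - of_real (ln (real k)))"
proof -
  have dom: "1 - z \<notin> \<real>\<^sub>\<le>\<^sub>0" if "cmod z < 1" for z
  proof -
    have "0 < Re (1 - z)"
      using that complex_Re_le_cmod[of z] by simp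
    then show ?thesis
      by (auto simp: complex_nonpos_Reals_iff)
  qed
  have pow: "cmod (z ^ k) < 1" if "cmod z < 1" for z
    using that assms by (simp add: norm_power power_less_one_iff)
  show ?thesis
    unfolding is_log_branch_def
  proof (intro conjI ballI)
    show "(\<lambda>z. Ln (1 - z ^ k) - Ln (1 - z) - of_real (ln (real k))) holomorphic_on ball 0 1"
      by (intro holomorphic_intros) (use dom pow in auto)
    fix z :: complex assume "z \<in> ball 0 1"
    then have z: "cmod z < 1"
      by simp
    have nz: "1 - z \<noteq> 0" "1 - z ^ k \<noteq> 0"
      using dom[OF z] dom[OF pow[OF z]] by auto
    have "1 - z ^ k = (1 - z) * (\<Sum>j<k. z ^ j)"
      by (rule one_diff_power_eq)
    then show "exp (Ln (1 - z ^ k) - Ln (1 - z) - of_real (ln (real k))) = (\<Sum>j<k. z ^ j) / of_nat k"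
      using nz assms by (simp add: exp_diff exp_of_real)
  next
    show "Ln (1 - 0 ^ k) - Ln (1 - 0) - complex_of_real (ln (real k)) = - complex_of_real (ln (real k))"
      using assms by (simp add: power_0_left)
  qed
qed

lemma is_log_branch_log_branch: "k \<ge> 1 \<Longrightarrow> is_log_branch k (log_branch k)"
  unfolding log_branch_def using is_log_branch_exists by (rule someI_ex)

text \<open>The three summands belong to the constant, to \<open>- Ln (1 - z)\<close> and to \<open>Ln (1 - z ^ k)\<close>. At
  \<open>n = 0\<close> the last two vanish, since division by zero gives zero.\<close>

definition log_coeff :: "nat \<Rightarrow> nat \<Rightarrow> real" where
  "log_coeff k n =
     (if n = 0 then - ln (real k) else 0) + 1 / real n - (if k dvd n then real k / real n else 0)"

lemma log_branch_has_fps_expansion: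
  assumes k: "k \<ge> 1"
  shows "log_branch k has_fps_expansion Abs_fps (\<lambda>n. of_real (log_coeff k n))"
proof (rule has_fps_expansionI)
  have ev: "eventually (\<lambda>z. z \<in> ball (0::complex) 1) (nhds 0)"
    by (intro eventually_nhds_in_open) auto
  show "eventually (\<lambda>z. (\<lambda>n. fps_nth (Abs_fps (\<lambda>n. of_real (log_coeff k n))) n * z ^ n)
          sums log_branch k z) (nhds 0)"
    using ev
  proof eventually_elim
    case (elim z)
    then have z: "cmod z < 1"
      by simp
    then have zk: "cmod (z ^ k) < 1"
      using k by (simp add: norm_power power_less_one_iff)
    have log: "log_branch k z = Ln (1 - z ^ k) - Ln (1 - z) - of_real (ln (real k))"
      by (rule is_log_branch_unique[OF is_log_branch_log_branch[OF k] is_log_branch_Ln[OF k] elim])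
    have one: "(\<lambda>n. z ^ n / of_nat n) sums - Ln (1 - z)"
      using sums_minus[OF Ln_series'[of "- z"]] z by simp
    define f where "f = (\<lambda>n. (if k dvd n then of_nat k / of_nat n else 0) * z ^ n)"
    have "(\<lambda>n. f (k * n)) sums - Ln (1 - z ^ k)"
      using sums_minus[OF Ln_series'[of "- (z ^ k)"]] zk k by (simp add: f_def power_mult)
    moreover have "strict_mono (\<lambda>n. k * n)"
      using k by (simp add: strict_mono_def)
    ultimately have two: "f sums - Ln (1 - z ^ k)"
      by (subst (asm) sums_mono_reindex) (auto simp: f_def)
    have const: "(\<lambda>n. if n = 0 then - complex_of_real (ln (real k)) else 0) sums
                   - complex_of_real (ln (real k))"
      by (rule sums_single)
    have eq: "fps_nth (Abs_fps (\<lambda>n. of_real (log_coeff k n))) n * z ^ n =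
            (if n = 0 then - complex_of_real (ln (real k)) else 0) + z ^ n / of_nat n - f n" for n
      by (auto simp: log_coeff_def f_def algebra_simps)
    show ?case
      unfolding eq log using sums_diff[OF sums_add[OF const one] two] by (simp add: algebra_simps)
  qed
qed

lemma h_holomorphic:
  assumes "k \<ge> 1"
  shows "h k holomorphic_on ball 0 1"
proof -
  have "log_branch k holomorphic_on ball 0 1"
    using is_log_branch_log_branch[OF assms] by (simp add: is_log_branch_def)
  then have "(\<lambda>z. 1 / (1 - z) * log_branch k z) holomorphic_on ball 0 1"
    by (intro holomorphic_intros) auto
  then show ?thesis
    by (simp add: h_def[abs_def])
qed

text \<open>Division by \<open>1 - z\<close> replaces a coefficient sequence by its partial sums.\<close>

lemma taylor_coeff_h_sum:
  assumes "k \<ge> 1"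
  shows "taylor_coeff (h k) n = (\<Sum>i\<le>n. of_real (log_coeff k i))"
proof -
  let ?L = "Abs_fps (\<lambda>n. complex_of_real (log_coeff k n))"
  have "(\<lambda>z. inverse (1 - z)) has_fps_expansion inverse (1 - fps_X :: complex fps)"
    by (intro fps_expansion_intros) auto
  then have "(\<lambda>z. log_branch k z * inverse (1 - z)) has_fps_expansion ?L * inverse (1 - fps_X)"
    using log_branch_has_fps_expansion[OF assms] by (intro has_fps_expansion_mult)
  then have "h k has_fps_expansion ?L * inverse (1 - fps_X)"
    by (simp add: h_def[abs_def] field_simps)
  then have "taylor_coeff (h k) n = fps_nth (?L * inverse (1 - fps_X)) n"
    by (rule taylor_coeff_eqI)
  also have "\<dots> = (\<Sum>i\<le>n. of_real (log_coeff k i))"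
    by (simp add: fps_inverse_one_minus_fps_X(1) fps_mult_nth atLeast0AtMost)
  finally show ?thesis .
qed

lemma sum_log_coeff:
  assumes "k \<ge> 1"
  shows "(\<Sum>i\<le>n. log_coeff k i) = harm n - harm (n div k) - ln (real k)"
proof (induction n)
  case 0
  then show ?case
    by (simp add: log_coeff_def harm_expand)
next
  case (Suc n)
  have "real k / real (Suc n) = 1 / real (Suc (n div k))" if dv: "k dvd Suc n"
  proof -
    have "Suc n = k * Suc (n div k)"
      using dv by (metis div_Suc dvd_eq_mod_eq_0 dvd_mult_div_cancel)
    then have "real (Suc n) = real k * real (Suc (n div k))"
      by (metis of_nat_mult)
    then show ?thesis
      using assms by simp
  qed
  then show ?case
    using Suc by (auto simp: log_coeff_def div_Suc harm_Suc dvd_eq_mod_eq_0 inverse_eq_divide)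
qed

lemma taylor_coeff_h:
  assumes "k \<ge> 1"
  shows "taylor_coeff (h k) n = of_real (harm n - harm (n div k) - ln (real k))"
  using taylor_coeff_h_sum[OF assms, of n] sum_log_coeff[OF assms, of n]
  by (metis of_real_sum)

lemma harm_minus_ln_bounds:
  "euler_mascheroni - 1 / (real n + 1) \<le> harm n - ln (real n + 1)"
  "harm n - ln (real n + 1) \<le> (euler_mascheroni :: real)"
proof -
  show "euler_mascheroni - 1 / (real n + 1) \<le> harm n - ln (real n + 1)"
  proof (cases n)
    case 0
    then show ?thesis
      using euler_mascheroni_less_13_over_22 by (simp add: harm_expand)
  next
    case (Suc m)
    have "1 / real (2 * (m + 1)) \<le> 1 / (real n + 1)"
      by (simp add: Suc field_simps)
    then show ?thesis
      using euler_mascheroni_upper[of m] by (simp add: Suc add_ac)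
  qed
  show "harm n - ln (real n + 1) \<le> (euler_mascheroni :: real)"
  proof (cases n)
    case 0
    then show ?thesis
      using euler_mascheroni_pos by (simp add: harm_expand)
  next
    case (Suc m)
    have "0 \<le> 1 / real (2 * (m + 2))"
      by simp
    then have "harm (Suc m) - ln (real (m + 2)) \<le> (euler_mascheroni :: real)"
      using euler_mascheroni_lower[of m] by linarith
    then show ?thesis
      by (simp add: Suc add_ac)
  qed
qed

text \<open>Harmonic numbers are logarithms up to Euler's constant, which cancels in the difference,
  and an error of order \<open>1 / n\<close>; and \<open>n + 1\<close> differs from \<open>k * (n div k + 1)\<close> by less
  than \<open>k\<close>.\<close>

lemma harm_diff_ln_bound:
  assumes k: "k \<ge> 1"
  shows "\<bar>harm n - harm (n div k) - ln (real k)\<bar> \<le> 2 * real k / (real n + 1)"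
proof -
  define m where "m = n div k"
  define N where "N = real n + 1"
  define M where "M = real k * (real m + 1)"
  have n: "n = k * m + n mod k"
    by (simp add: m_def)
  have "n mod k \<le> k - 1"
    using k by (metis Suc_pred' less_Suc_eq_le mod_less_divisor One_nat_def Suc_le_eq)
  then have "n + 1 \<le> k * (m + 1)" "k * (m + 1) \<le> n + k"
    using n k by simp_all
  then have "real (n + 1) \<le> real (k * (m + 1))" "real (k * (m + 1)) \<le> real (n + k)"
    by (simp_all only: of_nat_le_iff)
  then have NM: "N \<le> M" "M \<le> N + (real k - 1)"
    by (simp_all add: N_def M_def algebra_simps)
  have pos: "N > 0" "M > 0"
    using k by (simp_all add: N_def M_def)
  have lnM: "ln M = ln (real k) + ln (real m + 1)"
    using k by (simp add: M_def ln_mult)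
  have "ln N \<le> ln M"
    using NM pos by simp
  moreover have "ln M - ln N \<le> M / N - 1"
    using pos ln_le_minus_one[of "M / N"] by (simp add: ln_div)
  moreover have "M / N - 1 \<le> (real k - 1) / N"
    using NM pos divide_right_mono[of "M - N" "real k - 1" N] by (simp add: diff_divide_distrib)
  moreover have "1 / (real m + 1) \<le> real k / N"
    using NM(1) pos by (simp add: field_simps M_def)
  moreover have "1 / N \<le> real k / N"
    using k pos by (simp add: divide_right_mono)
  moreover have "(real k - 1) / N + 1 / N = real k / N"
    by (simp add: add_divide_distrib[symmetric])
  moreover have "2 * real k / N = real k / N + real k / N"
    by simp
  ultimately show ?thesis
    using harm_minus_ln_bounds[of n] harm_minus_ln_bounds[of m] lnM
    unfolding N_def[symmetric] m_def[symmetric] by (simp only: abs_le_iff) linarith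
qed

lemma h_in_hardy_space:
  assumes k: "k \<ge> 1"
  shows "h k \<in> hardy_space"
proof -
  have "summable (\<lambda>n. 1 / (real n + 1)\<^sup>2)"
    using inverse_squares_sums by (simp add: sums_iff add_ac)
  then have sm: "summable (\<lambda>n. (2 * real k)\<^sup>2 * (1 / (real n + 1)\<^sup>2))"
    by (rule summable_mult)
  have bound: "norm ((cmod (taylor_coeff (h k) n))\<^sup>2) \<le> (2 * real k)\<^sup>2 * (1 / (real n + 1)\<^sup>2)" for n
  proof -
    have "cmod (taylor_coeff (h k) n) \<le> 2 * real k / (real n + 1)"
      unfolding taylor_coeff_h[OF k] norm_of_real by (rule harm_diff_ln_bound[OF k])
    then have "(cmod (taylor_coeff (h k) n))\<^sup>2 \<le> (2 * real k / (real n + 1))\<^sup>2"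
      by (intro power_mono) auto
    then show ?thesis
      by (simp add: power_divide)
  qed
  have "summable (\<lambda>n. (cmod (taylor_coeff (h k) n))\<^sup>2)"
    by (rule summable_comparison_test'[OF sm, of 0]) (rule bound)
  then show ?thesis
    using h_holomorphic[OF k] by (simp add: hardy_space_def)
qed


section \<open>Biorthogonality\<close>

definition diff_power :: "nat \<Rightarrow> complex \<Rightarrow> complex" where
  "diff_power n z = z ^ (n - 1) - z ^ n"

lemma diff_power_in_hardy_space: "diff_power n \<in> hardy_space"
  unfolding diff_power_def[abs_def] by (intro hardy_space_diff hardy_space_power)

lemma taylor_coeff_diff_power:
  "taylor_coeff (diff_power d) n = (if n = d - 1 then 1 else 0) - (if n = d then 1 else 0)"
proof -
  have "taylor_coeff (\<lambda>z. z ^ (d - 1) + (-1) * z ^ d) n =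
          taylor_coeff (\<lambda>z. z ^ (d - 1)) n + taylor_coeff (\<lambda>z. (-1) * z ^ d) n"
    by (intro taylor_coeff_add holomorphic_intros)
  also have "taylor_coeff (\<lambda>z. (-1) * z ^ d) n = (-1) * taylor_coeff (\<lambda>z. z ^ d) n"
    by (intro taylor_coeff_cmult holomorphic_intros)
  finally show ?thesis
    by (simp add: diff_power_def[abs_def] taylor_coeff_power)
qed

lemma u_eq_sum_diff_power:
  "u k = (\<lambda>z. \<Sum>d | d dvd k. of_int (moebius_mu (k div d)) / of_nat (k div d) * diff_power d z)"
  by (simp add: u_def[abs_def] diff_power_def)

lemma u_in_hardy_space: "u k \<in> hardy_space"
  unfolding u_eq_sum_diff_power
  by (intro hardy_subspace_sum hardy_subspace_hardy_space hardy_space_cmult diff_power_in_hardy_space)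

text \<open>The inner product with the polynomial \<open>u j\<close> is a finite sum, so \<open>f\<close> can be arbitrary.\<close>

lemma hardy_inner_u:
  "hardy_inner f (u j) =
     (\<Sum>d | d dvd j. of_int (moebius_mu (j div d)) / of_nat (j div d) *
        (taylor_coeff f (d - 1) - taylor_coeff f d))"
proof -
  let ?c = "\<lambda>d. of_int (moebius_mu (j div d)) / of_nat (j div d) :: complex"
  let ?a = "taylor_coeff f"
  have coeff: "taylor_coeff (u j) n = (\<Sum>d | d dvd j. ?c d * taylor_coeff (diff_power d) n)" for n
    unfolding u_eq_sum_diff_power
    by (simp only: taylor_coeff_sum hardy_space_holomorphic hardy_space_cmult taylor_coeff_cmult
          diff_power_in_hardy_space)
  have one: "(\<lambda>n. ?c d * (?a n * taylor_coeff (diff_power d) n)) sums (?c d * (?a (d - 1) - ?a d))" for d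
  proof -
    have "(\<lambda>n. (if n = d - 1 then ?a n else 0) - (if n = d then ?a n else 0)) sums (?a (d - 1) - ?a d)"
      by (intro sums_diff sums_single)
    moreover have "(if n = d - 1 then ?a n else 0) - (if n = d then ?a n else 0)
        = ?a n * taylor_coeff (diff_power d) n" for n
      by (simp add: taylor_coeff_diff_power)
    ultimately show ?thesis
      by (intro sums_mult) simp
  qed
  have "(\<lambda>n. \<Sum>d | d dvd j. ?c d * (?a n * taylor_coeff (diff_power d) n)) sums
          (\<Sum>d | d dvd j. ?c d * (?a (d - 1) - ?a d))"
    by (intro sums_sum one)
  moreover have "(\<Sum>d | d dvd j. ?c d * (?a n * taylor_coeff (diff_power d) n)) =
      ?a n * cnj (taylor_coeff (u j) n)" for n
    unfolding coeff sum_distrib_left cnj_sum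
    by (intro sum.cong) (auto simp: taylor_coeff_diff_power)
  ultimately show ?thesis
    unfolding hardy_inner_def by (simp add: sums_iff)
qed

text \<open>Pairing with \<open>z ^ (d - 1) - z ^ d\<close> takes minus the difference of consecutive partial sums,
  so it recovers a coefficient of the logarithm. After multiplication by \<open>j\<close> this leaves the
  sum of \<open>moebius_mu (j div d) * (k * [k dvd d] - 1)\<close>, in which the first part is \<open>k\<close> if
  \<open>j = k\<close> and vanishes otherwise, and the second part vanishes as \<open>j > 1\<close>.\<close>

lemma hardy_inner_h_u:
  assumes k: "k \<ge> 1" and j: "j \<ge> 2"
  shows "hardy_inner (h k) (u j) = (if k = j then 1 else 0)"
proof -
  have fin: "finite {d. d dvd j}"
    using j by simp
  have summand: "of_int (moebius_mu (j div d)) / of_nat (j div d) *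
        (taylor_coeff (h k) (d - 1) - taylor_coeff (h k) d) =
      complex_of_int (moebius_mu (j div d) * (if k dvd d then int k else 0) - moebius_mu (j div d))
        / of_nat j"
    if d: "d dvd j" for d
  proof -
    obtain m where m: "j = d * m"
      using d ..
    have pos: "d > 0" "m > 0"
      using m j by (auto intro: Nat.gr0I)
    then obtain e where e: "d = Suc e"
      using gr0_implies_Suc by blast
    have "taylor_coeff (h k) (d - 1) - taylor_coeff (h k) d = - of_real (log_coeff k d)"
      by (simp add: taylor_coeff_h_sum[OF k] e)
    also have "\<dots> = ((if k dvd d then of_nat k else 0) - 1) / of_nat d"
      using pos by (simp add: log_coeff_def diff_divide_distrib)
    finally have diff: "taylor_coeff (h k) (d - 1) - taylor_coeff (h k) d =
        ((if k dvd d then of_nat k else 0) - 1) / of_nat d" .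
    show ?thesis
      unfolding diff using pos by (simp add: m field_simps)
  qed
  have "hardy_inner (h k) (u j) =
      (\<Sum>d | d dvd j. complex_of_int (moebius_mu (j div d) * (if k dvd d then int k else 0)
         - moebius_mu (j div d)) / of_nat j)"
    unfolding hardy_inner_u using summand by (intro sum.cong) auto
  also have "\<dots> = complex_of_int (\<Sum>d | d dvd j. moebius_mu (j div d) * (if k dvd d then int k else 0)
         - moebius_mu (j div d)) / of_nat j"
    by (simp only: sum_divide_distrib of_int_sum)
  also have "(\<Sum>d | d dvd j. moebius_mu (j div d) * (if k dvd d then int k else 0)
         - moebius_mu (j div d)) = (if j = k then int k else 0)"
  proof -
    have "(\<Sum>d | d dvd j. moebius_mu (j div d) * (if k dvd d then int k else 0)) =
        (\<Sum>d | d dvd j \<and> k dvd d. moebius_mu (j div d) * int k)"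
      using fin by (intro sum.mono_neutral_cong_right) auto
    also have "\<dots> = (if j = k then int k else 0)"
      using sum_moebius_mu_multiples[of j k] k j by (simp add: sum_distrib_right[symmetric])
    finally show ?thesis
      using sum_moebius_mu_codivisors[of j] j by (simp add: sum_subtractf)
  qed
  finally show ?thesis
    using j by auto
qed


section \<open>Completeness\<close>

abbreviation u_span :: "(complex \<Rightarrow> complex) set" where
  "u_span \<equiv> complex_span (u ` {2..})"

lemma hardy_subspace_u_span: "hardy_subspace u_span"
  by (intro hardy_subspace_complex_span) (auto simp: u_in_hardy_space)

text \<open>This is Moebius inversion of the definition of \<open>u\<close>. Since \<open>u 1 = diff_power 1\<close> does not
  belong to the family, \<open>n * diff_power n\<close> is only reached modulo \<open>diff_power 1\<close>; the correction is the
  same for all \<open>n\<close> because the values \<open>moebius_mu (n div d)\<close> add up to zero.\<close>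

lemma diff_power_congruent_in_u_span:
  assumes "n > 0"
  shows "(\<lambda>z. of_nat n * diff_power n z - diff_power 1 z) \<in> u_span"
  using assms
proof (induction n rule: less_induct)
  case (less n)
  show ?case
  proof (cases "n = 1")
    case True
    then show ?thesis
      using hardy_subspace_zero[OF hardy_subspace_u_span] by simp
  next
    case False
    then have n: "n \<ge> 2"
      using less.prems by simp
    let ?D = "{d. d dvd n}"
    let ?v = "\<lambda>d z. of_nat d * diff_power d z - diff_power 1 z"
    let ?\<mu> = "\<lambda>d. complex_of_int (moebius_mu (n div d))"
    have fin: "finite ?D"
      using n by simp
    have un: "of_nat n * u n z = (\<Sum>d\<in>?D. ?\<mu> d * (of_nat d * diff_power d z))" for z
      unfolding u_eq_sum_diff_power sum_distrib_left
    proof (intro sum.cong refl)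
      fix d assume "d \<in> ?D"
      then obtain m where m: "n = d * m"
        by auto
      with n have "d > 0" "m > 0"
        by (auto intro: Nat.gr0I)
      then show "of_nat n * (?\<mu> d / of_nat (n div d) * diff_power d z) =
          ?\<mu> d * (of_nat d * diff_power d z)"
        by (simp add: m)
    qed
    have mu0: "(\<Sum>d\<in>?D. ?\<mu> d) = 0"
      using sum_moebius_mu_codivisors[of n] n by (simp flip: of_int_sum)
    have "of_nat n * u n z = (\<Sum>d\<in>?D. ?\<mu> d * ?v d z)" for z
      using mu0 unfolding un
      by (simp add: right_diff_distrib sum_subtractf sum_distrib_right[symmetric])
    also have "(\<Sum>d\<in>?D. ?\<mu> d * ?v d z) = ?v n z + (\<Sum>d\<in>?D - {n}. ?\<mu> d * ?v d z)" for z
      using fin n by (subst sum.remove[of _ n]) (auto simp: moebius_mu_def)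
    finally have eq: "?v n = (\<lambda>z. of_nat n * u n z - (\<Sum>d\<in>?D - {n}. ?\<mu> d * ?v d z))"
      by (auto simp: fun_eq_iff algebra_simps)
    have v: "?v d \<in> u_span" if "d \<in> ?D - {n}" for d
      
    proof (rule less.IH)
      show "d < n" "0 < d"
        using that n dvd_imp_le[of d n] by (auto intro: Nat.gr0I)
    qed
    have un_span: "u n \<in> u_span"
      using n by (intro in_complex_span) auto
    note sub = hardy_subspace_u_span
    show ?thesis
      by (subst eq) (rule hardy_subspace_diff[OF sub hardy_subspace_cmult[OF sub un_span]
            hardy_subspace_sum[OF sub hardy_subspace_cmult[OF sub v]]])
  qed
qed

text \<open>With \<open>S = 1/2 + \<dots> + 1/N\<close>, averaging the functions \<open>n * diff_power n - diff_power 1\<close> with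
  weights \<open>1 / (n * S)\<close> telescopes to \<open>(z - z ^ N) / S - diff_power 1\<close>. The first term has norm
  at most \<open>2 / S\<close>, which tends to zero because the harmonic series diverges.\<close>

lemma diff_power_1_in_closure: "diff_power 1 \<in> hardy_closure u_span"
proof (rule hardy_closure_closed[OF hardy_subspace_u_span diff_power_in_hardy_space])
  fix e :: real assume "e > 0"
  obtain N where N: "exp (2 / e + 1) \<le> real N"
    using real_arch_simple by blast
  define S :: real where "S = (\<Sum>n\<in>{2..N}. 1 / real n)"
  have "1 < exp (2 / e + 1)"
    using \<open>e > 0\<close> by (simp add: add_pos_pos)
  then have "real N > 1"
    using N by linarith
  then have N2: "N \<ge> 2"
    by simp
  have "2 / e + 1 < ln (real N + 1)"
    using N ln_less_cancel_iff[of "exp (2 / e + 1)" "real N + 1"] by simp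
  also have "\<dots> \<le> harm N"
    by (rule harm_ge_ln)
  also have "harm N = 1 + S"
    unfolding harm_def S_def using N2
    by (subst sum.atLeast_Suc_atMost) (auto simp: inverse_eq_divide numeral_2_eq_2)
  finally have S: "2 / e < S"
    by simp
  then have S0: "S > 0"
    using \<open>e > 0\<close> by (meson divide_pos_pos less_trans zero_less_numeral)
  let ?v = "\<lambda>n z. of_nat n * diff_power n z - diff_power 1 z"
  define g where "g = (\<lambda>z. (-1 / of_real S) * (\<Sum>n\<in>{2..N}. (1 / of_nat n) * ?v n z))"
  have "g \<in> u_span"
    unfolding g_def
    by (intro hardy_subspace_cmult hardy_subspace_sum hardy_subspace_u_span
        diff_power_congruent_in_u_span) auto
  then have "g \<in> hardy_closure u_span"
    by (rule hardy_closure_superset[OF hardy_subspace_u_span])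
  moreover have "hardy_norm (\<lambda>z. diff_power 1 z - g z) < e"
  proof -
    have tele: "(\<Sum>n\<in>{2..N}. diff_power n z) = z - z ^ N" for z
      using N2 by (induction N rule: dec_induct) (auto simp: diff_power_def)
    have "(\<Sum>n\<in>{2..N}. (1 / of_nat n) * ?v n z) =
        (\<Sum>n\<in>{2..N}. diff_power n z - of_real (1 / real n) * diff_power 1 z)" for z
      by (intro sum.cong) (auto simp: field_simps)
    then have weighted: "(\<Sum>n\<in>{2..N}. (1 / of_nat n) * ?v n z) = z - z ^ N - of_real S * diff_power 1 z" for z
      by (simp only: sum_subtractf tele sum_distrib_right[symmetric] S_def of_real_sum)
    then have eq: "(\<lambda>z. diff_power 1 z - g z) = (\<lambda>z. of_real (1 / S) * (z ^ 1 + (-1) * z ^ N))"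
      unfolding g_def weighted using S0 by (simp add: field_simps)
    have mem: "(\<lambda>z. z ^ 1 + (-1) * z ^ N) \<in> hardy_space"
      by (intro hardy_space_add hardy_space_power hardy_space_cmult)
    have "hardy_norm (\<lambda>z. z ^ 1 + (-1) * z ^ N) \<le> hardy_norm (\<lambda>z. z ^ 1) + hardy_norm (\<lambda>z. (-1) * z ^ N)"
      by (intro hardy_norm_triangle hardy_space_power hardy_space_cmult)
    also have "\<dots> = 2"
      by (subst hardy_norm_cmult) (simp_all only: hardy_norm_power hardy_space_power, simp)
    finally have "hardy_norm (\<lambda>z. z ^ 1 + (-1) * z ^ N) \<le> 2" .
    then have "hardy_norm (\<lambda>z. diff_power 1 z - g z) \<le> 2 / S"
      unfolding eq hardy_norm_cmult[OF mem] using S0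
      by (simp add: norm_divide divide_right_mono)
    also have "\<dots> < e"
      using S S0 \<open>e > 0\<close> by (simp add: field_simps)
    finally show ?thesis .
  qed
  ultimately show "\<exists>g\<in>hardy_closure u_span. hardy_norm (\<lambda>z. diff_power 1 z - g z) < e"
    by blast
qed

lemma one_minus_power_in_closure: "(\<lambda>z. 1 - z ^ n) \<in> hardy_closure u_span"
proof -
  note sub = hardy_subspace_closure[OF hardy_subspace_u_span]
  have "diff_power d \<in> hardy_closure u_span" if "d > 0" for d
  proof -
    have "(\<lambda>z. (1 / of_nat d) * ((of_nat d * diff_power d z - diff_power 1 z) + diff_power 1 z))
        \<in> hardy_closure u_span"
      using that by (intro hardy_subspace_cmult hardy_subspace_add sub diff_power_1_in_closure
          hardy_closure_superset[OF hardy_subspace_u_span] diff_power_congruent_in_u_span)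
    then show ?thesis
      using that by simp
  qed
  then have "(\<lambda>z. \<Sum>d\<in>{1..n}. diff_power d z) \<in> hardy_closure u_span"
    by (intro hardy_subspace_sum sub) auto
  moreover have "(\<Sum>d\<in>{1..n}. diff_power d z) = 1 - z ^ n" for z
    by (induction n) (auto simp: diff_power_def)
  ultimately show ?thesis
    by simp
qed

text \<open>The mean of \<open>1 - z ^ n\<close> over \<open>1 \<le> n \<le> N\<close> differs from 1 by the mean of \<open>N\<close> orthonormal
  functions, which has norm \<open>1 / sqrt N\<close>.\<close>

lemma one_in_closure: "(\<lambda>z. 1) \<in> hardy_closure u_span"
proof (rule hardy_closure_closed[OF hardy_subspace_u_span])
  show "(\<lambda>z. 1) \<in> hardy_space"
    using hardy_space_power[of 0] by simp
  fix e :: real assume "e > 0"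
  obtain N where N: "1 / e\<^sup>2 < real N"
    using reals_Archimedean2 by blast
  have "0 < 1 / e\<^sup>2"
    using \<open>e > 0\<close> by simp
  then have N0: "real N > 0"
    using N by linarith
  define g where "g = (\<lambda>z::complex. (1 / of_nat N) * (\<Sum>n\<in>{1..N}. 1 - z ^ n))"
  have "g \<in> hardy_closure u_span"
    unfolding g_def
    by (intro hardy_subspace_cmult hardy_subspace_sum hardy_subspace_closure hardy_subspace_u_span
        one_minus_power_in_closure)
  moreover have "hardy_norm (\<lambda>z. 1 - g z) < e"
  proof -
    have "1 - g z = (\<Sum>n\<in>{1..N}. (1 / of_nat N) * z ^ n)" for z
      using N0 by (simp add: g_def sum_subtractf sum_divide_distrib[symmetric] field_simps)
    then have "hardy_norm (\<lambda>z. 1 - g z) = sqrt (1 / real N)"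
      using N0 by (simp only: hardy_norm_polynomial[OF finite_atLeastAtMost])
         (simp add: norm_divide power2_eq_square)
    also have "\<dots> < e"
      using N N0 \<open>e > 0\<close> by (intro real_less_lsqrt) (auto simp: field_simps)
    finally show ?thesis .
  qed
  ultimately show "\<exists>g\<in>hardy_closure u_span. hardy_norm (\<lambda>z. 1 - g z) < e"
    by blast
qed

lemma hardy_complete_u: "hardy_complete {2..} u"
proof -
  note sub = hardy_subspace_closure[OF hardy_subspace_u_span]
  have "(\<lambda>z. z ^ n) \<in> hardy_closure u_span" for n
    using hardy_subspace_diff[OF sub one_in_closure one_minus_power_in_closure[of n]] by simp
  then have "hardy_space \<subseteq> hardy_closure u_span"
    by (rule hardy_space_subset_closure_if_powers[OF hardy_subspace_u_span])
  then show ?thesis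
    using hardy_subspace_space[OF hardy_subspace_u_span]
    unfolding hardy_complete_def hardy_dense_def hardy_closure_def by blast
qed

theorem theorem15:
  shows "hardy_complete {2..} u \<and> hardy_biorthogonal {2..} h u"
  using hardy_complete_u
  by (auto simp: hardy_biorthogonal_def h_in_hardy_space u_in_hardy_space hardy_inner_h_u)

end
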